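(* Let $\mathcal{L}$ and $\mathcal{M}$ be set systems and let $R\subseteq(\bigcup\mathcal{L})\times P(\bigcup\mathcal{M})$. Let $\mathfrak{O}_R:P(\bigcup\mathcal{M})\to P(\bigcup\mathcal{L})$ be given by $\mathfrak{O}_R(A)=\{x\in\bigcup\mathcal{L}:\exists v\subseteq A,\ R(x,v)\}$. Then for every $A\in\mathcal{M}$, the set $\mathfrak{O}_R(A)$ is upper-closed with respect to the quasi-ordering $Q_R(\mathrm{qo}(\mathcal{M}))$; that is, $\mathfrak{O}_R[\mathcal{M}]\subseteq\mathrm{ss}(Q_R(\mathrm{qo}(\mathcal{M})))$.
   Context: A set system over $T$ is a family $\mathcal{L}\subseteq P(T)$. For a set system $\mathcal{M}$, $\mathrm{qo}(\mathcal{M})=(\bigcup\mathcal{M},\preceq)$ where $x\preceq y$ iff for every $M\in\mathcal{M}$, $x\in M$ implies $y\in M$. For a quasi-ordering $(X,\preceq)$, the powerset ordering on $P(X)$ is $v\preceq^\forall_\exists v'$ iff for every $x'\in v'$ there is $x\in v$ with $x\preceq x'$. Given $R\subseteq(\bigcup\mathcal{L})\times P(\bigcup\mathcal{M})$ and a quasi-ordering $\mathcal{X}=(\bigcup\mathcal{M},\preceq)$, $Q_R(\mathcal{X})$ is the relation $\sqsubseteq$ on $\bigcup\mathcal{L}$ with $x\sqsubseteq x'$ iff for every $v$ with $R(x,v)$ there is $v'$ with $R(x',v')$ and $v\preceq^\forall_\exists v'$ (this is a quasi-ordering). For a quasi-ordering $\mathcal{Y}=(Y,\sqsubseteq)$,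 $\mathrm{ss}(\mathcal{Y})$ is the set of upper-closed subsets of $Y$, i.e. $A\subseteq Y$ with $x\in A$, $x\sqsubseteq y$ implying $y\in A$. *)

theory Defs
  imports Main
begin

definition set_system :: "'a set \<Rightarrow> 'a set set \<Rightarrow> bool" where
  "set_system T L \<longleftrightarrow> L \<subseteq> Pow T"

text \<open>A quasi-ordering is represented as a pair of a carrier and a relation on it; the pairs
  that actually are quasi-orderings are singled out by \<^const>\<open>preorder_on\<close>.\<close>

type_synonym 'a qord = "'a set \<times> 'a rel"

definition quasi_ordering :: "'a qord \<Rightarrow> bool" where
  "quasi_ordering X \<longleftrightarrow> preorder_on (fst X) (snd X)"

definition qo :: "'a set set \<Rightarrow> 'a qord" where
  "qo M = (\<Union>M, {(x, y). x \<in> \<Union>M \<and> y \<in> \<Union>M \<and> (\<forall>A\<in>M. x \<in> A \<longrightarrow> y \<in> A)})"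

definition powerset_ordering :: "'a qord \<Rightarrow> 'a set rel" where
  "powerset_ordering X =
     {(v, v'). v \<in> Pow (fst X) \<and> v' \<in> Pow (fst X) \<and> (\<forall>x'\<in>v'. \<exists>x\<in>v. (x, x') \<in> snd X)}"

text \<open>The relation \<open>R\<close> alone does not determine the set on which the resulting
  quasi-ordering lives, hence the additional parameter \<open>L\<close> here and in \<open>O_op\<close>.\<close>

definition Q :: "'a set set \<Rightarrow> ('a \<times> 'b set) set \<Rightarrow> 'b qord \<Rightarrow> 'a qord" where
  "Q L R X =
     (\<Union>L, {(x, x'). x \<in> \<Union>L \<and> x' \<in> \<Union>L \<and>
        (\<forall>v. (x, v) \<in> R \<longrightarrow> (\<exists>v'. (x', v') \<in> R \<and> (v, v') \<in> powerset_ordering X))})"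

definition upper_closed :: "'a qord \<Rightarrow> 'a set \<Rightarrow> bool" where
  "upper_closed Y A \<longleftrightarrow> A \<subseteq> fst Y \<and> (\<forall>x y. x \<in> A \<longrightarrow> (x, y) \<in> snd Y \<longrightarrow> y \<in> A)"

definition ss :: "'a qord \<Rightarrow> 'a set set" where
  "ss Y = {A. upper_closed Y A}"

definition O_op :: "'a set set \<Rightarrow> ('a \<times> 'b set) set \<Rightarrow> 'b set \<Rightarrow> 'a set" where
  "O_op L R A = {x \<in> \<Union>L. \<exists>v. v \<subseteq> A \<and> (x, v) \<in> R}"

lemma quasi_ordering_qo: "quasi_ordering (qo M)"
proof -
  have "trans (snd (qo M))"
    by (rule transI) (simp add: qo_def)
  then show ?thesis
    unfolding quasi_ordering_def preorder_on_def refl_on_def by (auto simp: qo_def)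
qed

lemma quasi_ordering_powerset_ordering:
  assumes "quasi_ordering X"
  shows "quasi_ordering (Pow (fst X), powerset_ordering X)"
proof -
  have refl: "(x, x) \<in> snd X" if "x \<in> fst X" for x
    using assms that unfolding quasi_ordering_def preorder_on_def refl_on_def by blast
  have tr: "trans (snd X)"
    using assms unfolding quasi_ordering_def preorder_on_def by blast
  have "trans (powerset_ordering X)"
  proof (rule transI)
    fix u v w
    assume uv: "(u, v) \<in> powerset_ordering X" and vw: "(v, w) \<in> powerset_ordering X"
    have "\<exists>x\<in>u. (x, z) \<in> snd X" if "z \<in> w" for z
    proof -
      obtain y where "y \<in> v" "(y, z) \<in> snd X"
        using vw \<open>z \<in> w\<close> unfolding powerset_ordering_def by blast
      moreover obtain x where "x \<in> u" "(x, y) \<in> snd X"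
        using uv \<open>y \<in> v\<close> unfolding powerset_ordering_def by blast
      ultimately show ?thesis
        using transD[OF tr] by blast
    qed
    then show "(u, w) \<in> powerset_ordering X"
      using uv vw unfolding powerset_ordering_def by blast
  qed
  moreover have "(v, v) \<in> powerset_ordering X" if "v \<in> Pow (fst X)" for v
    using that refl unfolding powerset_ordering_def by blast
  moreover have "powerset_ordering X \<subseteq> Pow (fst X) \<times> Pow (fst X)"
    unfolding powerset_ordering_def by blast
  ultimately show ?thesis
    unfolding quasi_ordering_def preorder_on_def refl_on_def by simp
qed

lemma quasi_ordering_Q:
  assumes "quasi_ordering X" and R: "R \<subseteq> \<Union>L \<times> Pow (fst X)"
  shows "quasi_ordering (Q L R X)"
proof -
  have refl: "(v, v) \<in> powerset_ordering X" if "v \<in> Pow (fst X)" for v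
    using quasi_ordering_powerset_ordering[OF assms(1)] that
    unfolding quasi_ordering_def preorder_on_def refl_on_def by simp
  have tr: "trans (powerset_ordering X)"
    using quasi_ordering_powerset_ordering[OF assms(1)]
    unfolding quasi_ordering_def preorder_on_def by simp
  have Q_iff: "(x, y) \<in> snd (Q L R X) \<longleftrightarrow> x \<in> \<Union>L \<and> y \<in> \<Union>L \<and>
      (\<forall>v. (x, v) \<in> R \<longrightarrow> (\<exists>w. (y, w) \<in> R \<and> (v, w) \<in> powerset_ordering X))" for x y
    by (simp add: Q_def)
  have "trans (snd (Q L R X))"
  proof (rule transI)
    fix x y z
    assume xy: "(x, y) \<in> snd (Q L R X)" and yz: "(y, z) \<in> snd (Q L R X)"
    have "\<exists>w. (z, w) \<in> R \<and> (u, w) \<in> powerset_ordering X" if "(x, u) \<in> R" for u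
    proof -
      obtain v where "(y, v) \<in> R" "(u, v) \<in> powerset_ordering X"
        using xy \<open>(x, u) \<in> R\<close> unfolding Q_iff by blast
      moreover obtain w where "(z, w) \<in> R" "(v, w) \<in> powerset_ordering X"
        using yz \<open>(y, v) \<in> R\<close> unfolding Q_iff by blast
      ultimately show ?thesis
        using transD[OF tr] by blast
    qed
    then show "(x, z) \<in> snd (Q L R X)"
      using xy yz unfolding Q_iff by blast
  qed
  moreover have "(x, x) \<in> snd (Q L R X)" if "x \<in> \<Union>L" for x
    using that refl R unfolding Q_iff by blast
  moreover have "snd (Q L R X) \<subseteq> \<Union>L \<times> \<Union>L"
    unfolding Q_def by auto
  moreover have "fst (Q L R X) = \<Union>L"
    by (simp add: Q_def)
  ultimately show ?thesis
    unfolding quasi_ordering_def preorder_on_def refl_on_def by simp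
qed

end

theory Submission
  imports Defs
begin

text \<open>Every \<open>A\<close> in \<open>M\<close> is upper-closed for \<open>qo M\<close>, by
  the very definition of that ordering. The powerset ordering puts each element of the larger set
  above some element of the smaller one, so containment in \<open>A\<close> passes from
  \<open>v\<close> to any \<open>w\<close> above it (\<open>powerset_ordering_qo_subset\<close>).
  Hence a witness for membership in \<open>O_op L R A\<close> can be carried upward along
  \<open>Q\<close>.\<close>

lemma powerset_ordering_qo_subset:
  assumes "(v, w) \<in> powerset_ordering (qo M)" and "A \<in> M" and "v \<subseteq> A"
  shows "w \<subseteq> A"
  using assms unfolding powerset_ordering_def qo_def by fastforce

lemma upper_closed_O_op:
  assumes "A \<in> M"
  shows "upper_closed (Q L R (qo M)) (O_op L R A)"
  unfolding upper_closed_def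
proof (intro conjI allI impI)
  show "O_op L R A \<subseteq> fst (Q L R (qo M))"
    by (auto simp: O_op_def Q_def)
next
  fix x y
  assume "x \<in> O_op L R A" and xy: "(x, y) \<in> snd (Q L R (qo M))"
  then obtain v where "v \<subseteq> A" "(x, v) \<in> R"
    unfolding O_op_def by blast
  \<comment> \<open>The ordering \<open>Q\<close> answers the witness \<open>v\<close> of
    \<open>x\<close> with some \<open>w\<close> related to \<open>y\<close>; since \<open>w\<close>
    stays inside \<open>A\<close>, it is the witness for \<open>y\<close>.\<close>
  moreover from xy \<open>(x, v) \<in> R\<close> obtain w
    where "(y, w) \<in> R" "(v, w) \<in> powerset_ordering (qo M)" and "y \<in> \<Union>L"
    unfolding Q_def by auto
  ultimately show "y \<in> O_op L R A"
    using powerset_ordering_qo_subset[OF _ assms] unfolding O_op_def by blast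
qed

theorem theorem1:
  fixes S :: "'a set" and T :: "'b set"
    and L :: "'a set set" and M :: "'b set set"
    and R :: "('a \<times> 'b set) set"
  assumes "set_system S L" and "set_system T M"
    and "R \<subseteq> \<Union>L \<times> Pow (\<Union>M)"
  shows "(\<forall>A\<in>M. upper_closed (Q L R (qo M)) (O_op L R A)) \<and>
         O_op L R ` M \<subseteq> ss (Q L R (qo M))"
  using upper_closed_O_op by (auto simp: ss_def)

end
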